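(* The metric space $(\mathbb{G}^*,d)$ is compact.
   Context: Graphs are simple. $\mathbb{G}$ denotes the set of isomorphism types of countable (finite or countably infinite, not necessarily locally finite) connected rooted graphs, where isomorphisms of rooted graphs are graph isomorphisms mapping root to root. A rooted connected induced subgraph (RCIS) of a rooted graph $(G,o)$ is a connected induced subgraph of $G$ that contains $o$ and is also rooted at $o$. For rooted graphs $G,H$, the radius of similarity $r(G,H)\in\mathbb{N}\cup\{\infty\}$ is the supremum of all $r\in\mathbb{N}$ such that every rooted graph on at most $r$ vertices is isomorphic to a RCIS of $G$ if and only if it is isomorphic to a RCIS of $H$. Let $d(G,H)=1/r(G,H)$, with $d(G,H)=0$ if $r(G,H)=\infty$. This $d$ is a pseudometric on $\mathbb{G}$ (indeed it satisfies the ultrametric inequality). $\mathbb{G}^*$ denotes the quotient of $\mathbb{G}$ by the equivalence relation $d(G,H)=0$, with the induced metric again denoted by $d$. *)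

theory Defs
  imports Complex_Main "HOL-Library.Extended_Nat"
begin

section \<open>Rooted graphs\<close>

record 'a rgraph =
  verts :: "'a set"
  edges :: "'a rel"
  root :: 'a

text \<open>Simple undirected graphs are irreflexive symmetric relations on their vertex set.\<close>

definition rooted_graph :: "'a rgraph \<Rightarrow> bool" where
  "rooted_graph G \<longleftrightarrow> edges G \<subseteq> verts G \<times> verts G \<and> sym (edges G) \<and> irrefl (edges G)
     \<and> root G \<in> verts G"

definition connected_graph :: "'a rgraph \<Rightarrow> bool" where
  "connected_graph G \<longleftrightarrow> (\<forall>u\<in>verts G. \<forall>v\<in>verts G. (u, v) \<in> (edges G)\<^sup>*)"

definition rooted_iso_map :: "('a \<Rightarrow> 'b) \<Rightarrow> 'a rgraph \<Rightarrow> 'b rgraph \<Rightarrow> bool" where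
  "rooted_iso_map f G H \<longleftrightarrow> bij_betw f (verts G) (verts H) \<and> f (root G) = root H
     \<and> (\<forall>u\<in>verts G. \<forall>v\<in>verts G. (u, v) \<in> edges G \<longleftrightarrow> (f u, f v) \<in> edges H)"

definition rooted_iso :: "'a rgraph \<Rightarrow> 'b rgraph \<Rightarrow> bool" where
  "rooted_iso G H \<longleftrightarrow> (\<exists>f. rooted_iso_map f G H)"

definition induced_subgraph :: "'a rgraph \<Rightarrow> 'a set \<Rightarrow> 'a rgraph" where
  "induced_subgraph G S = \<lparr>verts = S, edges = edges G \<inter> S \<times> S, root = root G\<rparr>"

definition is_RCIS :: "'a rgraph \<Rightarrow> 'a rgraph \<Rightarrow> bool" where
  "is_RCIS F G \<longleftrightarrow> (\<exists>S. S \<subseteq> verts G \<and> root G \<in> S \<and> F = induced_subgraph G S \<and> connected_graph F)"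

definition has_RCIS :: "'a rgraph \<Rightarrow> 'b rgraph \<Rightarrow> bool" where
  "has_RCIS G F \<longleftrightarrow> (\<exists>F'. is_RCIS F' G \<and> rooted_iso F F')"

section \<open>Radius of similarity\<close>

text \<open>A countable graph, finite or infinite, is isomorphic to one whose vertices are natural numbers.
  Hence \<^typ>\<open>nat rgraph\<close> provides representatives of all the countable graphs, and it also
  suffices for the finite test graphs \<open>F\<close> below.\<close>

definition similar :: "nat \<Rightarrow> nat rgraph \<Rightarrow> nat rgraph \<Rightarrow> bool" where
  "similar r G H \<longleftrightarrow> (\<forall>F :: nat rgraph. rooted_graph F \<and> finite (verts F) \<and> card (verts F) \<le> r
     \<longrightarrow> (has_RCIS G F \<longleftrightarrow> has_RCIS H F))"

definition similarity_radius :: "nat rgraph \<Rightarrow> nat rgraph \<Rightarrow> enat" where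
  "similarity_radius G H = Sup {enat r | r. similar r G H}"

section \<open>Isomorphism types of countable connected rooted graphs\<close>

lemma rooted_iso_refl: "rooted_iso G G"
  unfolding rooted_iso_def rooted_iso_map_def by (rule exI[of _ id]) auto

lemma rooted_iso_map_inv:
  assumes f: "rooted_iso_map f G H" and G: "root G \<in> verts G"
  shows "rooted_iso_map (inv_into (verts G) f) H G"
proof -
  let ?g = "inv_into (verts G) f"
  have b: "bij_betw f (verts G) (verts H)" and r: "f (root G) = root H"
    and e: "\<And>u v. u \<in> verts G \<Longrightarrow> v \<in> verts G \<Longrightarrow> (u, v) \<in> edges G \<longleftrightarrow> (f u, f v) \<in> edges H"
    using f unfolding rooted_iso_map_def by auto
  have g: "bij_betw ?g (verts H) (verts G)" using b by (rule bij_betw_inv_into)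
  have "?g (root H) = root G" using bij_betw_inv_into_left[OF b G] r by simp
  moreover have "(u, v) \<in> edges H \<longleftrightarrow> (?g u, ?g v) \<in> edges G"
    if u: "u \<in> verts H" and v: "v \<in> verts H" for u v
    using e[OF bij_betw_apply[OF g u] bij_betw_apply[OF g v]]
      bij_betw_inv_into_right[OF b u] bij_betw_inv_into_right[OF b v] by simp
  ultimately show ?thesis using g unfolding rooted_iso_map_def by blast
qed

lemma rooted_iso_sym: "rooted_iso G H \<Longrightarrow> root G \<in> verts G \<Longrightarrow> rooted_iso H G"
  unfolding rooted_iso_def using rooted_iso_map_inv by blast

lemma rooted_iso_trans:
  assumes "rooted_iso G H" "rooted_iso H K"
  shows "rooted_iso G K"
proof -
  obtain f g where f: "rooted_iso_map f G H" and g: "rooted_iso_map g H K"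
    using assms unfolding rooted_iso_def by blast
  have "rooted_iso_map (g \<circ> f) G K"
    using f g bij_betw_trans[of f "verts G" "verts H" g "verts K"]
    unfolding rooted_iso_map_def by (auto dest: bij_betwE)
  then show ?thesis unfolding rooted_iso_def by blast
qed

lemma rooted_iso_connected:
  assumes f: "rooted_iso_map f G H" and G: "edges G \<subseteq> verts G \<times> verts G" "connected_graph G"
  shows "connected_graph H"
proof -
  have *: "(f u, f v) \<in> (edges H)\<^sup>*" if "(u, v) \<in> (edges G)\<^sup>*" for u v
    using that
  proof induction
    case base
    then show ?case by simp
  next
    case (step y z)
    have "y \<in> verts G" "z \<in> verts G" using step.hyps(2) G(1) by auto
    then have "(f y, f z) \<in> edges H" using step.hyps(2) f unfolding rooted_iso_map_def by simp
    with step.IH show ?case by (rule rtrancl_into_rtrancl)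
  qed
  have "verts H = f ` verts G" using f unfolding rooted_iso_map_def bij_betw_def by auto
  with * G(2) show ?thesis unfolding connected_graph_def by simp
qed

lemma rooted_iso_map_restrict:
  assumes f: "rooted_iso_map f G H" and S: "S \<subseteq> verts G"
  shows "rooted_iso_map f (induced_subgraph G S) (induced_subgraph H (f ` S))"
proof -
  have "bij_betw f S (f ` S)"
    using f S unfolding rooted_iso_map_def by (meson bij_betw_subset order_refl)
  then show ?thesis
    using f S unfolding rooted_iso_map_def induced_subgraph_def by auto
qed

lemma has_RCIS_iso:
  assumes "rooted_iso G H" "has_RCIS G F"
  shows "has_RCIS H F"
proof -
  obtain f where f: "rooted_iso_map f G H" using assms(1) unfolding rooted_iso_def by blast
  obtain S where S: "S \<subseteq> verts G" "root G \<in> S" "connected_graph (induced_subgraph G S)"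
    "rooted_iso F (induced_subgraph G S)"
    using assms(2) unfolding has_RCIS_def is_RCIS_def by blast
  note fS = rooted_iso_map_restrict[OF f S(1)]
  have "connected_graph (induced_subgraph H (f ` S))"
    using rooted_iso_connected[OF fS _ S(3)] by (auto simp: induced_subgraph_def)
  moreover have "f ` S \<subseteq> verts H"
    using f S(1) unfolding rooted_iso_map_def bij_betw_def by auto
  moreover have "root H \<in> f ` S"
    using f S(2) unfolding rooted_iso_map_def by force
  moreover have "rooted_iso F (induced_subgraph H (f ` S))"
    using rooted_iso_trans[OF S(4)] fS unfolding rooted_iso_def by blast
  ultimately show ?thesis unfolding has_RCIS_def is_RCIS_def by blast
qed

definition same_type :: "nat rgraph \<Rightarrow> nat rgraph \<Rightarrow> bool" where
  "same_type G H \<longleftrightarrow> rooted_graph G \<and> connected_graph G \<and> rooted_graph H \<and> connected_graph H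
     \<and> rooted_iso G H"

text \<open>The relation is partial because only connected rooted graphs have a type.\<close>

quotient_type graph_type = "nat rgraph" / partial: same_type
proof (rule part_equivpI)
  let ?G = "\<lparr>verts = {0}, edges = {}, root = 0\<rparr> :: nat rgraph"
  have "same_type ?G ?G"
    by (auto simp: same_type_def rooted_graph_def connected_graph_def rooted_iso_refl sym_def irrefl_def)
  then show "\<exists>G. same_type G G" by blast
  show "symp same_type"
    by (rule sympI) (auto simp: same_type_def rooted_graph_def intro: rooted_iso_sym)
  show "transp same_type"
    by (rule transpI) (auto simp: same_type_def intro: rooted_iso_trans)
qed

lemma same_type_has_RCIS: "same_type G H \<Longrightarrow> has_RCIS G F \<longleftrightarrow> has_RCIS H F"
  using has_RCIS_iso rooted_iso_sym unfolding same_type_def rooted_graph_def by metis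

lift_definition type_radius :: "graph_type \<Rightarrow> graph_type \<Rightarrow> enat" is similarity_radius
  by (simp add: similarity_radius_def similar_def same_type_has_RCIS)

text \<open>Graphs with at most one vertex never separate, so the radius is at least 1
  (\<open>type_radius_pos\<close> below) and the division is proper.\<close>

definition type_dist :: "graph_type \<Rightarrow> graph_type \<Rightarrow> real" where
  "type_dist G H = (case type_radius G H of enat r \<Rightarrow> 1 / real r | \<infinity> \<Rightarrow> 0)"

section \<open>The pseudometric\<close>

lemma similar_mono: "similar s G H \<Longrightarrow> r \<le> s \<Longrightarrow> similar r G H"
  unfolding similar_def by (meson order_trans)

lemma le_similarity_radius: "enat r \<le> similarity_radius G H \<longleftrightarrow> similar r G H"
proof
  assume le: "enat r \<le> similarity_radius G H"
  show "similar r G H"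
  proof (cases r)
    case 0
    then show ?thesis unfolding similar_def rooted_graph_def by auto
  next
    case (Suc n)
    then have "enat n < similarity_radius G H" using le by (simp add: Suc_ile_eq)
    then obtain s where "n < s" "similar s G H"
      unfolding similarity_radius_def less_Sup_iff by auto
    then show ?thesis using Suc similar_mono by auto
  qed
next
  assume "similar r G H"
  then show "enat r \<le> similarity_radius G H"
    unfolding similarity_radius_def by (intro Sup_upper) auto
qed

lemma has_RCIS_single:
  assumes G: "rooted_graph G" and F: "rooted_graph F" "finite (verts F)" "card (verts F) \<le> 1"
  shows "has_RCIS G F"
proof -
  have "verts F = {root F}"
    using F unfolding rooted_graph_def by (auto simp: card_le_Suc0_iff_eq)
  moreover have "edges F = {}"
    using F(1) calculation unfolding rooted_graph_def irrefl_def by fastforce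
  ultimately have "rooted_iso_map (\<lambda>_. root G) F (induced_subgraph G {root G})"
    using G unfolding rooted_iso_map_def induced_subgraph_def rooted_graph_def irrefl_def
    by (auto simp: bij_betw_def)
  moreover have "is_RCIS (induced_subgraph G {root G}) G"
    using G unfolding is_RCIS_def rooted_graph_def
    by (intro exI[of _ "{root G}"]) (auto simp: connected_graph_def induced_subgraph_def)
  ultimately show ?thesis unfolding has_RCIS_def rooted_iso_def by blast
qed

lemma similar_1: "rooted_graph G \<Longrightarrow> rooted_graph H \<Longrightarrow> similar 1 G H"
  unfolding similar_def using has_RCIS_single by blast

lemma type_radius_pos: "1 \<le> type_radius G H"
  by transfer (auto simp: one_enat_def le_similarity_radius same_type_def intro: similar_1[simplified])

lemma similar_commute: "similar r G H \<longleftrightarrow> similar r H G"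
  unfolding similar_def by (intro iff_allI imp_cong refl eq_commute)

lemma similarity_radius_commute: "similarity_radius G H = similarity_radius H G"
  unfolding similarity_radius_def by (subst similar_commute) (rule refl)

lemma type_radius_commute: "type_radius G H = type_radius H G"
  by transfer (rule similarity_radius_commute)

lemma enat_leI:
  assumes "\<And>r. enat r \<le> a \<Longrightarrow> enat r \<le> b"
  shows "a \<le> (b :: enat)"
proof (rule ccontr)
  assume "\<not> a \<le> b"
  then obtain n where n: "b = enat n" "enat n < a" by (cases b) auto
  then have "enat (Suc n) \<le> a" by (simp add: Suc_ile_eq)
  then show False using assms[of "Suc n"] n(1) by simp
qed

lemma type_radius_refl: "type_radius G G = \<infinity>"
proof -
  have "enat r \<le> type_radius G G" for r
    by transfer (simp add: le_similarity_radius similar_def)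
  then have "\<infinity> \<le> type_radius G G" by (rule enat_leI)
  then show ?thesis by simp
qed

lemma type_radius_ultra: "min (type_radius G H) (type_radius H K) \<le> type_radius G K"
proof (rule enat_leI)
  fix r assume "enat r \<le> min (type_radius G H) (type_radius H K)"
  then show "enat r \<le> type_radius G K"
    by transfer (simp add: le_similarity_radius similar_def)
qed

lemma type_dist_eq_0: "type_dist G H = 0 \<longleftrightarrow> type_radius G H = \<infinity>"
  using type_radius_pos[of G H] unfolding type_dist_def
  by (auto simp: one_enat_def split: enat.splits)

lemma type_dist_nonneg: "0 \<le> type_dist G H"
  unfolding type_dist_def by (auto split: enat.splits)

lemma type_dist_commute: "type_dist G H = type_dist H G"
  unfolding type_dist_def by (simp add: type_radius_commute)

lemma type_dist_ultra: "type_dist G K \<le> max (type_dist G H) (type_dist H K)"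
proof -
  have *: "type_dist A B \<le> type_dist C D" if "type_radius C D \<le> type_radius A B" for A B C D
    using that type_radius_pos[of A B] type_radius_pos[of C D] unfolding type_dist_def
    by (auto simp: one_enat_def split: enat.splits intro: divide_left_mono)
  have "type_radius G H \<le> type_radius G K \<or> type_radius H K \<le> type_radius G K"
    using type_radius_ultra[of G H K] by (simp add: min_le_iff_disj)
  then show ?thesis using *[of G H G K] *[of H K G K] by (auto simp: le_max_iff_disj)
qed

lemma type_dist_triangle: "type_dist G K \<le> type_dist G H + type_dist H K"
  using type_dist_ultra[of G K H] type_dist_nonneg[of G H] type_dist_nonneg[of H K] by linarith

section \<open>The quotient metric space\<close>

quotient_type graph_space = graph_type / "\<lambda>G H. type_dist G H = 0"
proof (rule equivpI)
  show "reflp (\<lambda>G H. type_dist G H = 0)"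
    by (rule reflpI) (simp add: type_dist_eq_0 type_radius_refl)
  show "symp (\<lambda>G H. type_dist G H = 0)"
    by (rule sympI) (simp add: type_dist_commute)
  show "transp (\<lambda>G H. type_dist G H = 0)"
    by (rule transpI) (use type_dist_triangle type_dist_nonneg in \<open>smt (verit)\<close>)
qed

lemma type_dist_cong:
  assumes "type_dist G G' = 0" "type_dist H H' = 0"
  shows "type_dist G H = type_dist G' H'"
  using assms type_dist_triangle[of G H G'] type_dist_triangle[of G' H H']
    type_dist_triangle[of G' H' G] type_dist_triangle[of G H' H]
    type_dist_commute[of G G'] type_dist_commute[of H H'] by linarith

instantiation graph_space :: metric_space
begin

lift_definition dist_graph_space :: "graph_space \<Rightarrow> graph_space \<Rightarrow> real" is type_dist
  by (rule type_dist_cong)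

definition uniformity_graph_space :: "(graph_space \<times> graph_space) filter" where
  "uniformity_graph_space = (INF e\<in>{0<..}. principal {(x, y). dist x y < e})"

definition open_graph_space :: "graph_space set \<Rightarrow> bool" where
  "open_graph_space U \<longleftrightarrow> (\<forall>x\<in>U. \<forall>\<^sub>F (x', y) in uniformity. x' = x \<longrightarrow> y \<in> U)"

instance
proof
  fix x y z :: graph_space
  show "dist x y = 0 \<longleftrightarrow> x = y" by transfer (rule refl)
  show "dist x y \<le> dist x z + dist y z"
  proof transfer
    fix x y z
    show "type_dist x y \<le> type_dist x z + type_dist y z"
      using type_dist_triangle[of x y z] type_dist_commute[of y z] by linarith
  qed
next
  show "(uniformity :: (graph_space \<times> graph_space) filter)
      = (INF e\<in>{0<..}. principal {(x, y). dist x y < e})"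
    by (rule uniformity_graph_space_def)
next
  fix U :: "graph_space set"
  show "open U \<longleftrightarrow> (\<forall>x\<in>U. \<forall>\<^sub>F (x', y) in uniformity. x' = x \<longrightarrow> y \<in> U)"
    by (rule open_graph_space_def)
qed

end

end

theory Submission
  imports Defs "HOL-Analysis.Elementary_Metric_Spaces"
begin

text \<open>A metric space is compact iff it is totally bounded and complete.

  Total boundedness: whether two graphs are \<open>1 / r\<close>-close depends only on which test graphs with
  vertices in \<open>{..<r}\<close> they contain, and there are finitely many such test graphs
  (\<open>similar_by_initial_segment\<close>).

  Completeness: along a Cauchy sequence \<open>G n\<close>, the answer to ``does \<open>G n\<close> contain \<open>F\<close>?'' is eventually
  constant for every finite \<open>F\<close>. A limit is a countable graph whose finite RCISs are exactly the
  \<open>F\<close> that are eventually contained. The class of these \<open>F\<close> is hereditary, and it is directed: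
  copies of \<open>H\<close> and \<open>F\<close> in \<open>G n\<close> share the root, so their union is again connected and it has
  boundedly many vertices. Only finitely many graphs can arise as this union, so one of them arises
  for infinitely many \<open>n\<close> and, its presence being eventually constant, belongs to the class (\<open>eventual_age_joint_extension\<close>). As in
  the construction of a countable structure with a given age, directedness yields an increasing chain
  of members of the class that absorbs every member, and the union of the chain is the limit
  (\<open>graph_with_given_age\<close>). Degrees may grow without bound along the chain, so even for locally
  finite \<open>G n\<close> the limit can have vertices of infinite degree.\<close>

section \<open>Rooted embeddings\<close>

definition rooted_embedding :: "('a \<Rightarrow> 'b) \<Rightarrow> 'a rgraph \<Rightarrow> 'b rgraph \<Rightarrow> bool" where
  "rooted_embedding f F G \<longleftrightarrow> inj_on f (verts F) \<and> f ` verts F \<subseteq> verts G \<and> f (root F) = root G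
     \<and> (\<forall>u\<in>verts F. \<forall>v\<in>verts F. (u, v) \<in> edges F \<longleftrightarrow> (f u, f v) \<in> edges G)"

lemma rooted_embedding_comp:
  assumes "rooted_embedding f F G" "rooted_embedding g G H"
  shows "rooted_embedding (g \<circ> f) F H"
proof -
  have "inj_on (g \<circ> f) (verts F)"
    using assms unfolding rooted_embedding_def by (meson comp_inj_on inj_on_subset)
  then show ?thesis
    using assms unfolding rooted_embedding_def by (auto simp: image_subset_iff)
qed

lemma rooted_embedding_rtrancl:
  assumes f: "rooted_embedding f F G" and F: "edges F \<subseteq> verts F \<times> verts F"
    and uv: "(u, v) \<in> (edges F)\<^sup>*"
  shows "(f u, f v) \<in> (edges G)\<^sup>*"
  using uv
proof induction
  case (step y z)
  then have "(f y, f z) \<in> edges G" using f F unfolding rooted_embedding_def by blast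
  with step.IH show ?case by (rule rtrancl_into_rtrancl)
qed simp

lemma connected_graphI:
  assumes "sym (edges G)" and reach: "\<And>v. v \<in> verts G \<Longrightarrow> (root G, v) \<in> (edges G)\<^sup>*"
  shows "connected_graph G"
  unfolding connected_graph_def
proof (intro ballI)
  fix u v assume "u \<in> verts G" "v \<in> verts G"
  then have "(u, root G) \<in> (edges G)\<^sup>*" "(root G, v) \<in> (edges G)\<^sup>*"
    using reach sym_rtrancl[OF assms(1)] by (auto dest: symD)
  then show "(u, v) \<in> (edges G)\<^sup>*" by (rule rtrancl_trans)
qed

lemma connected_graph_reach:
  "rooted_graph G \<Longrightarrow> connected_graph G \<Longrightarrow> v \<in> verts G \<Longrightarrow> (root G, v) \<in> (edges G)\<^sup>*"
  unfolding rooted_graph_def connected_graph_def by blast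

text \<open>The image of an embedding is an induced copy of \<open>F\<close>, and a copy is connected iff \<open>F\<close> is. Embeddings compose, which makes them easier to
  handle than induced subgraphs paired with isomorphisms.\<close>

lemma has_RCIS_iff_embedding:
  assumes F: "rooted_graph F"
  shows "has_RCIS G F \<longleftrightarrow> connected_graph F \<and> (\<exists>f. rooted_embedding f F G)"
proof
  assume "has_RCIS G F"
  then obtain S f where S: "S \<subseteq> verts G" "connected_graph (induced_subgraph G S)"
    and f: "rooted_iso_map f F (induced_subgraph G S)"
    unfolding has_RCIS_def is_RCIS_def rooted_iso_def by blast
  have "rooted_iso_map (inv_into (verts F) f) (induced_subgraph G S) F"
    using rooted_iso_map_inv[OF f] F unfolding rooted_graph_def by blast
  then have "connected_graph F"
    using rooted_iso_connected S(2) by (fastforce simp: induced_subgraph_def)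
  moreover have "rooted_embedding f F G"
    using f S(1) unfolding rooted_iso_map_def rooted_embedding_def induced_subgraph_def bij_betw_def
    by auto
  ultimately show "connected_graph F \<and> (\<exists>f. rooted_embedding f F G)" by blast
next
  assume "connected_graph F \<and> (\<exists>f. rooted_embedding f F G)"
  then obtain f where c: "connected_graph F" and f: "rooted_embedding f F G" by blast
  let ?S = "f ` verts F"
  have i: "rooted_iso_map f F (induced_subgraph G ?S)"
    using f unfolding rooted_iso_map_def rooted_embedding_def induced_subgraph_def bij_betw_def
    by auto
  have "connected_graph (induced_subgraph G ?S)"
    using rooted_iso_connected[OF i _ c] F unfolding rooted_graph_def by blast
  moreover have "?S \<subseteq> verts G" "root G \<in> ?S"
    using f F unfolding rooted_embedding_def rooted_graph_def by (auto intro: rev_image_eqI)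
  ultimately show "has_RCIS G F"
    unfolding has_RCIS_def is_RCIS_def rooted_iso_def using i by blast
qed

lemma has_RCIS_trans:
  assumes "rooted_graph F" "rooted_graph H" "has_RCIS G H" "has_RCIS H F"
  shows "has_RCIS G F"
proof -
  obtain f g where "rooted_embedding g F H" "rooted_embedding f H G"
    using has_RCIS_iff_embedding[OF assms(1), of H] has_RCIS_iff_embedding[OF assms(2), of G] assms
    by blast
  then have "rooted_embedding (f \<circ> g) F G" by (rule rooted_embedding_comp)
  then show ?thesis
    using has_RCIS_iff_embedding[OF assms(1), of G] has_RCIS_iff_embedding[OF assms(1), of H] assms(4)
    by blast
qed

lemma has_RCIS_cong_iso:
  assumes "rooted_iso F F'" "rooted_graph F"
  shows "has_RCIS G F \<longleftrightarrow> has_RCIS G F'"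
proof -
  have "rooted_iso F' F" using assms rooted_iso_sym unfolding rooted_graph_def by blast
  with assms(1) show ?thesis unfolding has_RCIS_def by (meson rooted_iso_trans)
qed

section \<open>Finite graphs on natural numbers\<close>

lemma finite_rooted_graphs_on:
  assumes "finite W"
  shows "finite {F :: 'a rgraph. rooted_graph F \<and> verts F \<subseteq> W}"
proof (rule finite_imageD)
  let ?f = "\<lambda>F :: 'a rgraph. (verts F, edges F, root F)"
  show "finite (?f ` {F. rooted_graph F \<and> verts F \<subseteq> W})"
    by (rule finite_subset[of _ "Pow W \<times> Pow (W \<times> W) \<times> W"])
      (use assms in \<open>auto simp: rooted_graph_def\<close>)
  show "inj_on ?f {F. rooted_graph F \<and> verts F \<subseteq> W}"
    by (rule inj_onI) simp
qed

lemma countable_finite_rooted_graphs: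
  "countable {F :: ('a::countable) rgraph. rooted_graph F \<and> finite (verts F)}"
proof (rule countable_image_inj_on)
  let ?f = "\<lambda>F :: 'a rgraph. (verts F, edges F, root F)"
  have "countable (Collect finite \<times> Collect finite \<times> (UNIV :: 'a set) :: ('a set \<times> 'a rel \<times> 'a) set)"
    by (intro countable_SIGMA) (auto simp: countable_Collect_finite)
  moreover have "?f ` {F. rooted_graph F \<and> finite (verts F)} \<subseteq> Collect finite \<times> Collect finite \<times> UNIV"
    unfolding rooted_graph_def by (auto intro: finite_subset)
  ultimately show "countable (?f ` {F. rooted_graph F \<and> finite (verts F)})"
    by (meson countable_subset)
  show "inj_on ?f {F. rooted_graph F \<and> finite (verts F)}"
    by (rule inj_onI) simp
qed

text \<open>The set \<open>{..<r}\<close> is independent of \<open>F\<close>, so the test graphs of size at most \<open>r\<close> reduce to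
  finitely many concrete ones.\<close>

lemma finite_graph_iso_initial_segment:
  assumes F: "rooted_graph F" and fin: "finite (verts F)" "card (verts F) \<le> r"
  obtains F' :: "nat rgraph" where "rooted_graph F'" "verts F' \<subseteq> {..<r}" "rooted_iso F F'"
proof -
  obtain h where h: "bij_betw h (verts F) {0..<card (verts F)}"
    using ex_bij_betw_finite_nat[OF fin(1)] by blast
  then have inj: "inj_on h (verts F)" by (rule bij_betw_imp_inj_on)
  define F' where "F' = \<lparr>verts = h ` verts F, edges = map_prod h h ` edges F, root = h (root F)\<rparr>"
  have E: "edges F \<subseteq> verts F \<times> verts F" using F unfolding rooted_graph_def by blast
  have e: "(u, v) \<in> edges F \<longleftrightarrow> (h u, h v) \<in> edges F'" if "u \<in> verts F" "v \<in> verts F" for u v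
  proof
    assume "(h u, h v) \<in> edges F'"
    then obtain x y where xy: "(x, y) \<in> edges F" "h u = h x" "h v = h y"
      unfolding F'_def by auto
    then have "u = x" "v = y" using that E inj by (auto dest: inj_onD)
    with xy show "(u, v) \<in> edges F" by simp
  qed (auto simp: F'_def)
  have "rooted_graph F'"
    unfolding rooted_graph_def
  proof (intro conjI)
    show "edges F' \<subseteq> verts F' \<times> verts F'" using E unfolding F'_def by auto
    show "sym (edges F')"
      using F unfolding rooted_graph_def F'_def sym_def by auto
    show "irrefl (edges F')"
      unfolding irrefl_def
    proof (intro allI notI)
      fix a assume "(a, a) \<in> edges F'"
      then obtain x y where xy: "(x, y) \<in> edges F" "h x = h y" unfolding F'_def by auto
      then have "x = y" using E inj by (auto dest: inj_onD)
      with xy(1) F show False unfolding rooted_graph_def irrefl_def by blast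
    qed
    show "root F' \<in> verts F'" using F unfolding rooted_graph_def F'_def by simp
  qed
  moreover have "verts F' \<subseteq> {..<r}"
    using h fin(2) unfolding F'_def bij_betw_def by auto
  moreover have "rooted_iso_map h F F'"
    using e inj unfolding rooted_iso_map_def bij_betw_def by (auto simp: F'_def)
  ultimately show ?thesis using that unfolding rooted_iso_def by blast
qed

lemma similar_by_initial_segment:
  assumes "\<And>F :: nat rgraph. rooted_graph F \<Longrightarrow> verts F \<subseteq> {..<r} \<Longrightarrow> has_RCIS G F \<longleftrightarrow> has_RCIS H F"
  shows "similar r G H"
  unfolding similar_def
proof (intro allI impI; elim conjE)
  fix F :: "nat rgraph"
  assume F: "rooted_graph F" and "finite (verts F)" "card (verts F) \<le> r"
  then obtain F' :: "nat rgraph" where "rooted_graph F'" "verts F' \<subseteq> {..<r}" and i: "rooted_iso F F'"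
    using finite_graph_iso_initial_segment by blast
  then have "has_RCIS G F' \<longleftrightarrow> has_RCIS H F'" by (intro assms)
  then show "has_RCIS G F \<longleftrightarrow> has_RCIS H F"
    unfolding has_RCIS_cong_iso[OF i F] .
qed

section \<open>Joint extension\<close>

text \<open>The graph \<open>K\<close> is a copy of the union of the two images in \<open>G\<close>, relabelled so that \<open>H\<close> itself,
  not merely a copy of it, is an induced subgraph; this later allows unions of chains in place of
  abstract direct limits. The new vertices come from a set \<open>V\<close> chosen independently of \<open>G\<close>, so that
  only finitely many \<open>K\<close> can occur as \<open>G\<close> varies.\<close>

lemma joint_extension_in_graph:
  fixes F H :: "'a rgraph" and G :: "'b rgraph"
  assumes G: "rooted_graph G"
    and H: "rooted_graph H" "finite (verts H)" "has_RCIS G H"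
    and F: "rooted_graph F" "finite (verts F)" "has_RCIS G F"
    and V: "finite V" "card V = card (verts F)" "V \<inter> verts H = {}"
  obtains K where "rooted_graph K" "verts K \<subseteq> verts H \<union> V" "verts H \<subseteq> verts K"
    "induced_subgraph K (verts H) = H" "has_RCIS G K" "has_RCIS K F"
proof -
  obtain f where cH: "connected_graph H" and f: "rooted_embedding f H G"
    using H has_RCIS_iff_embedding by blast
  obtain g where cF: "connected_graph F" and g: "rooted_embedding g F G"
    using F has_RCIS_iff_embedding by blast
  let ?S = "f ` verts H" and ?T = "g ` verts F"
  have "card (?T - ?S) \<le> card V"
    using F(2) V(2) by (metis card_Diff_subset_Int card_image_le card_mono diff_le_self Diff_subset finite_imageI order_trans)
  then obtain U where U: "U \<subseteq> V" "card U = card (?T - ?S)" "finite U"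
    by (rule obtain_subset_with_card_n)
  obtain h where h: "bij_betw h U (?T - ?S)"
    using finite_same_card_bij[of U "?T - ?S"] U F(2) by auto
  \<comment> \<open>\<open>U\<close> supplies one name for each vertex of the copy of \<open>F\<close> outside the copy of \<open>H\<close>;
    \<open>K\<close> is the graph structure of \<open>G\<close> pulled back along \<open>k\<close>.\<close>
  define k where "k v = (if v \<in> verts H then f v else h v)" for v
  define K where "K = \<lparr>verts = verts H \<union> U,
    edges = {(u, v). u \<in> verts H \<union> U \<and> v \<in> verts H \<union> U \<and> (k u, k v) \<in> edges G}, root = root H\<rparr>"
  have kf: "bij_betw k (verts H) ?S"
    using f unfolding rooted_embedding_def bij_betw_def k_def by (auto simp: inj_on_def)
  have "bij_betw k U (?T - ?S)"
    using h by (rule bij_betw_cong[THEN iffD1, rotated]) (use U(1) V(3) in \<open>auto simp: k_def\<close>)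
  from bij_betw_combine[OF kf this] have k: "bij_betw k (verts K) (?S \<union> ?T)"
    by (simp add: K_def Un_Diff_cancel)
  have rH: "root H \<in> verts H" using H(1) unfolding rooted_graph_def by blast
  have kG: "rooted_embedding k K G"
    using k f g rH unfolding rooted_embedding_def bij_betw_def by (auto simp: K_def k_def)
  have K: "rooted_graph K"
    using G rH unfolding rooted_graph_def K_def by (auto simp: sym_def irrefl_def)
  have HK: "rooted_embedding id H K"
    using f unfolding rooted_embedding_def by (auto simp: K_def k_def)
  define l where "l = inv_into (verts K) k \<circ> g"
  have kl: "k (l v) = g v" "l v \<in> verts K" if "v \<in> verts F" for v
    using that k bij_betw_inv_into_right[OF k] bij_betwE[OF bij_betw_inv_into[OF k]]
    unfolding l_def by auto
  have FK: "rooted_embedding l F K"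
    unfolding rooted_embedding_def
  proof (intro conjI ballI)
    show "inj_on l (verts F)"
      using g kl(1) unfolding rooted_embedding_def by (metis inj_on_def)
    show "l ` verts F \<subseteq> verts K" using kl(2) by blast
    have "root F \<in> verts F" using F(1) unfolding rooted_graph_def by blast
    then have "k (l (root F)) = k (root K)" "l (root F) \<in> verts K" "root K \<in> verts K"
      using kl g kG K unfolding rooted_embedding_def rooted_graph_def by auto
    then show "l (root F) = root K" using k unfolding bij_betw_def inj_on_def by blast
    fix u v assume uv: "u \<in> verts F" "v \<in> verts F"
    then have "(u, v) \<in> edges F \<longleftrightarrow> (k (l u), k (l v)) \<in> edges G"
      using g kl(1) unfolding rooted_embedding_def by simp
    also have "\<dots> \<longleftrightarrow> (l u, l v) \<in> edges K"
      using kG kl(2) uv unfolding rooted_embedding_def by blast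
    finally show "(u, v) \<in> edges F \<longleftrightarrow> (l u, l v) \<in> edges K" .
  qed
  \<comment> \<open>Each vertex of \<open>K\<close> is joined to the common root inside the copy of \<open>H\<close> or that of \<open>F\<close>.\<close>
  have "connected_graph K"
  proof (rule connected_graphI)
    show "sym (edges K)" using K unfolding rooted_graph_def by blast
    fix v assume v: "v \<in> verts K"
    then have "k v \<in> ?S \<union> ?T" using k bij_betwE by blast
    then consider w where "w \<in> verts H" "k v = k w" | w where "w \<in> verts F" "k v = k (l w)"
      using kl(1) by (auto simp: k_def)
    then show "(root K, v) \<in> (edges K)\<^sup>*"
    proof cases
      case 1
      then have "v = w" using v k by (auto simp: K_def bij_betw_def inj_on_def)
      then have "(id (root H), id v) \<in> (edges K)\<^sup>*"
        using rooted_embedding_rtrancl[OF HK] connected_graph_reach[OF H(1) cH] 1 H(1)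
        unfolding rooted_graph_def by blast
      then show ?thesis by (simp add: K_def)
    next
      case 2
      then have "v = l w" using v k kl(2) by (auto simp: bij_betw_def inj_on_def)
      moreover have "(l (root F), l w) \<in> (edges K)\<^sup>*"
        using rooted_embedding_rtrancl[OF FK] connected_graph_reach[OF F(1) cF] 2 F(1)
        unfolding rooted_graph_def by blast
      ultimately show ?thesis using FK unfolding rooted_embedding_def by simp
    qed
  qed
  then have "has_RCIS G K" "has_RCIS K F"
    using kG FK cF has_RCIS_iff_embedding[OF K, of G] has_RCIS_iff_embedding[OF F(1), of K] by blast+
  moreover have "induced_subgraph K (verts H) = H"
  proof -
    have "edges K \<inter> verts H \<times> verts H = edges H"
      using HK H(1) unfolding rooted_embedding_def rooted_graph_def by auto
    then show ?thesis unfolding induced_subgraph_def by (simp add: K_def)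
  qed
  ultimately show ?thesis
    using that[of K] K U(1) by (auto simp: K_def)
qed

text \<open>The age of a structure is the class of its finite substructures.\<close>

definition eventual_age :: "(nat \<Rightarrow> nat rgraph) \<Rightarrow> nat rgraph set" where
  "eventual_age G = {F. rooted_graph F \<and> finite (verts F) \<and> (\<forall>\<^sub>F n in sequentially. has_RCIS (G n) F)}"

text \<open>By \<open>joint_extension_in_graph\<close>, every late \<open>G n\<close> contains a member of the fixed finite set \<open>\<K>\<close>. If
  each member were eventually absent, all of them would be absent at once from some late \<open>G n\<close>.\<close>

lemma eventual_age_joint_extension:
  assumes G: "\<And>n. rooted_graph (G n)"
    and dec: "\<And>F :: nat rgraph. rooted_graph F \<Longrightarrow> finite (verts F) \<Longrightarrow>
      (\<forall>\<^sub>F n in sequentially. has_RCIS (G n) F) \<or> (\<forall>\<^sub>F n in sequentially. \<not> has_RCIS (G n) F)"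
    and H: "H \<in> eventual_age G" and F: "F \<in> eventual_age G"
  shows "\<exists>K\<in>eventual_age G. verts H \<subseteq> verts K \<and> induced_subgraph K (verts H) = H \<and> has_RCIS K F"
proof -
  have H': "rooted_graph H" "finite (verts H)" and F': "rooted_graph F" "finite (verts F)"
    using H F unfolding eventual_age_def by auto
  have "infinite (- verts H)" using H'(2) by simp
  then obtain V where V: "finite V" "card V = card (verts F)" "V \<subseteq> - verts H"
    using infinite_arbitrarily_large by blast
  define \<K> where "\<K> = {K. rooted_graph K \<and> verts K \<subseteq> verts H \<union> V \<and> verts H \<subseteq> verts K
    \<and> induced_subgraph K (verts H) = H \<and> has_RCIS K F}"
  have fin: "finite \<K>"
    by (rule finite_subset[OF _ finite_rooted_graphs_on[of "verts H \<union> V"]])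
      (use H'(2) V(1) in \<open>auto simp: \<K>_def\<close>)
  have "\<forall>\<^sub>F n in sequentially. has_RCIS (G n) H \<and> has_RCIS (G n) F"
    using H F unfolding eventual_age_def by (simp add: eventually_conj)
  then have ev: "\<forall>\<^sub>F n in sequentially. \<exists>K\<in>\<K>. has_RCIS (G n) K"
  proof eventually_elim
    case (elim n)
    with V(3) obtain K where "rooted_graph K" "verts K \<subseteq> verts H \<union> V" "verts H \<subseteq> verts K"
      "induced_subgraph K (verts H) = H" "has_RCIS (G n) K" "has_RCIS K F"
      using joint_extension_in_graph[OF G H' _ F' _ V(1,2)] by blast
    then show ?case unfolding \<K>_def by blast
  qed
  have "\<exists>K\<in>\<K>. \<forall>\<^sub>F n in sequentially. has_RCIS (G n) K"
  proof (rule ccontr)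
    assume none: "\<not> ?thesis"
    have "\<forall>K\<in>\<K>. \<forall>\<^sub>F n in sequentially. \<not> has_RCIS (G n) K"
    proof (intro ballI)
      fix K assume K: "K \<in> \<K>"
      then have "rooted_graph K" "finite (verts K)"
        using H'(2) V(1) by (auto simp: \<K>_def intro: finite_subset)
      then show "\<forall>\<^sub>F n in sequentially. \<not> has_RCIS (G n) K"
        using dec none K by blast
    qed
    then have "\<forall>\<^sub>F n in sequentially. \<forall>K\<in>\<K>. \<not> has_RCIS (G n) K"
      using fin by (simp add: eventually_ball_finite)
    with ev have "\<forall>\<^sub>F n in sequentially. False" by eventually_elim blast
    then show False by simp
  qed
  then obtain K where "K \<in> \<K>" "\<forall>\<^sub>F n in sequentially. has_RCIS (G n) K" by blast
  moreover from this have "K \<in> eventual_age G"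
    unfolding eventual_age_def \<K>_def using H'(2) V(1) by (auto intro: finite_subset)
  ultimately show ?thesis unfolding \<K>_def by blast
qed

section \<open>Realising a directed hereditary class\<close>

text \<open>The chain \<open>H\<close> takes care of the \<open>n\<close>-th member of the countable class at step \<open>n\<close>. Every finite
  part of the union already lies in some \<open>H n\<close>, hence in \<open>\<A>\<close> by heredity.\<close>

lemma graph_with_given_age:
  fixes \<A> :: "nat rgraph set"
  assumes fin: "\<And>F. F \<in> \<A> \<Longrightarrow> rooted_graph F \<and> finite (verts F) \<and> connected_graph F"
    and ne: "\<A> \<noteq> {}"
    and her: "\<And>F H. H \<in> \<A> \<Longrightarrow> rooted_graph F \<Longrightarrow> finite (verts F) \<Longrightarrow> has_RCIS H F \<Longrightarrow> F \<in> \<A>"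
    and ext: "\<And>H F. H \<in> \<A> \<Longrightarrow> F \<in> \<A> \<Longrightarrow>
      \<exists>K\<in>\<A>. verts H \<subseteq> verts K \<and> induced_subgraph K (verts H) = H \<and> has_RCIS K F"
  obtains G :: "nat rgraph" where "rooted_graph G" "connected_graph G"
    "\<And>F. rooted_graph F \<Longrightarrow> finite (verts F) \<Longrightarrow> has_RCIS G F \<longleftrightarrow> F \<in> \<A>"
proof -
  have "countable \<A>"
    using countable_finite_rooted_graphs by (rule countable_subset[rotated]) (use fin in blast)
  then obtain e :: "nat \<Rightarrow> nat rgraph" where e: "range e = \<A>"
    using ne range_from_nat_into by metis
  have "\<exists>H. \<forall>n. H n \<in> \<A> \<and> (verts (H n) \<subseteq> verts (H (Suc n))
      \<and> induced_subgraph (H (Suc n)) (verts (H n)) = H n \<and> has_RCIS (H (Suc n)) (e n))"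
    by (rule dependent_nat_choice) (use ne ext e in blast)+
  then obtain H where HA: "\<And>n. H n \<in> \<A>" and sub: "\<And>n. verts (H n) \<subseteq> verts (H (Suc n))"
    and ind: "\<And>n. induced_subgraph (H (Suc n)) (verts (H n)) = H n"
    and He: "\<And>n. has_RCIS (H (Suc n)) (e n)" by blast
  note H = fin[OF HA]
  have mono: "verts (H m) \<subseteq> verts (H n)" if "m \<le> n" for m n
    using sub that by (rule lift_Suc_mono_le)
  have root: "root (H n) = root (H 0)" for n
  proof (induction n)
    case (Suc n)
    have "root (H (Suc n)) = root (H n)"
      using ind[of n] by (metis induced_subgraph_def rgraph.select_convs(3))
    with Suc show ?case by simp
  qed simp
  have edge_step: "(u, v) \<in> edges (H (Suc n)) \<longleftrightarrow> (u, v) \<in> edges (H n)"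
    if "u \<in> verts (H n)" "v \<in> verts (H n)" for u v n
  proof -
    have "edges (H n) = edges (H (Suc n)) \<inter> verts (H n) \<times> verts (H n)"
      using ind[of n] by (metis induced_subgraph_def rgraph.select_convs(2))
    then show ?thesis using that by blast
  qed
  have edge: "(u, v) \<in> edges (H n) \<longleftrightarrow> (u, v) \<in> edges (H m)"
    if "m \<le> n" "u \<in> verts (H m)" "v \<in> verts (H m)" for m n u v
    using that(1)
  proof (induction rule: dec_induct)
    case (step n)
    then show ?case using edge_step[of u n v] mono[OF step(1)] that by blast
  qed simp
  define G where "G = \<lparr>verts = (\<Union>n. verts (H n)), edges = (\<Union>n. edges (H n)), root = root (H 0)\<rparr>"
  have edgeG: "(u, v) \<in> edges G \<longleftrightarrow> (u, v) \<in> edges (H n)"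
    if uv: "u \<in> verts (H n)" "v \<in> verts (H n)" for u v n
  proof
    assume "(u, v) \<in> edges G"
    then obtain m where m: "(u, v) \<in> edges (H m)" by (auto simp: G_def)
    then have m': "u \<in> verts (H m)" "v \<in> verts (H m)" using H[of m] unfolding rooted_graph_def by auto
    show "(u, v) \<in> edges (H n)"
    proof (cases "m \<le> n")
      case True
      then show ?thesis using edge m m' by blast
    next
      case False
      then show ?thesis using edge m uv by (meson nat_le_linear)
    qed
  qed (auto simp: G_def)
  have HG: "rooted_embedding id (H n) G" for n
    using edgeG root[of n] unfolding rooted_embedding_def by (auto simp: G_def)
  have G: "rooted_graph G"
    using H unfolding rooted_graph_def G_def by (auto simp: sym_def irrefl_def, blast+)
  have "connected_graph G"
  proof (rule connected_graphI)
    show "sym (edges G)" using G unfolding rooted_graph_def by blast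
    fix v assume "v \<in> verts G"
    then obtain n where "v \<in> verts (H n)" by (auto simp: G_def)
    then have "(root (H n), v) \<in> (edges (H n))\<^sup>*"
      using connected_graph_reach[of "H n"] H[of n] by blast
    moreover have "edges (H n) \<subseteq> verts (H n) \<times> verts (H n)"
      using H[of n] unfolding rooted_graph_def by blast
    ultimately have "(id (root (H n)), id v) \<in> (edges G)\<^sup>*"
      using rooted_embedding_rtrancl[OF HG] by blast
    then show "(root G, v) \<in> (edges G)\<^sup>*" by (simp add: G_def root[of n])
  qed
  moreover have "has_RCIS G F \<longleftrightarrow> F \<in> \<A>" if F: "rooted_graph F" "finite (verts F)" for F
  proof
    assume "F \<in> \<A>"
    then obtain n where n: "F = e n" using e by blast
    have "has_RCIS G (H (Suc n))"
      using HG[of "Suc n"] H[of "Suc n"] has_RCIS_iff_embedding by blast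
    then show "has_RCIS G F"
      using has_RCIS_trans[OF F(1)] H[of "Suc n"] He[of n] n by blast
  next
    assume "has_RCIS G F"
    then obtain f where c: "connected_graph F" and f: "rooted_embedding f F G"
      using has_RCIS_iff_embedding F(1) by blast
    have "f ` verts F \<subseteq> (\<Union>n. verts (H n))" using f unfolding rooted_embedding_def by (simp add: G_def)
    then obtain n where n: "f ` verts F \<subseteq> verts (H n)"
    proof (rule finite_subset_Union_chain[rotated])
      show "finite (f ` verts F)" using F(2) by simp
      show "subset.chain UNIV (range (\<lambda>n. verts (H n)))"
        using mono nat_le_linear unfolding subset_chain_def by (metis rangeE subset_UNIV)
    qed (use that in blast)+
    have "rooted_embedding f F (H n)"
      using f n edgeG root[of n] unfolding rooted_embedding_def by (auto simp: G_def image_subset_iff)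
    then show "F \<in> \<A>"
      using her[OF HA F] c has_RCIS_iff_embedding F(1) by blast
  qed
  ultimately show ?thesis using that G by blast
qed

section \<open>Total boundedness and completeness\<close>

text \<open>The limit realises the eventual age, which is hereditary because containment is transitive and
  directed by \<open>eventual_age_joint_extension\<close>.\<close>

lemma limit_graph_exists:
  fixes G :: "nat \<Rightarrow> nat rgraph"
  assumes G: "\<And>n. rooted_graph (G n)"
    and dec: "\<And>F :: nat rgraph. rooted_graph F \<Longrightarrow> finite (verts F) \<Longrightarrow>
      (\<forall>\<^sub>F n in sequentially. has_RCIS (G n) F) \<or> (\<forall>\<^sub>F n in sequentially. \<not> has_RCIS (G n) F)"
  shows "\<exists>L :: nat rgraph. rooted_graph L \<and> connected_graph L \<and>
    (\<forall>F :: nat rgraph. rooted_graph F \<longrightarrow> finite (verts F) \<longrightarrow>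
      (has_RCIS L F \<longleftrightarrow> (\<forall>\<^sub>F n in sequentially. has_RCIS (G n) F)))"
proof (rule graph_with_given_age[of "eventual_age G"])
  show "rooted_graph F \<and> finite (verts F) \<and> connected_graph F" if "F \<in> eventual_age G" for F
  proof -
    have F: "rooted_graph F" "finite (verts F)" "\<forall>\<^sub>F n in sequentially. has_RCIS (G n) F"
      using that unfolding eventual_age_def by auto
    then have "\<exists>n. has_RCIS (G n) F" using eventually_happens[of _ sequentially] by auto
    then show ?thesis using F has_RCIS_iff_embedding by blast
  qed
  \<comment> \<open>The one-vertex graph is contained in every graph.\<close>
  have "\<lparr>verts = {0}, edges = {}, root = 0\<rparr> \<in> eventual_age G"
    unfolding eventual_age_def
    by (auto simp: rooted_graph_def sym_def irrefl_def intro!: always_eventually has_RCIS_single G)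
  then show "eventual_age G \<noteq> {}" by blast
  show "F \<in> eventual_age G"
    if "H \<in> eventual_age G" "rooted_graph F" "finite (verts F)" "has_RCIS H F" for F H
  proof -
    have H: "rooted_graph H" "\<forall>\<^sub>F n in sequentially. has_RCIS (G n) H"
      using that(1) unfolding eventual_age_def by auto
    have "\<forall>\<^sub>F n in sequentially. has_RCIS (G n) F"
      by (rule eventually_mono[OF H(2)]) (rule has_RCIS_trans[OF that(2) H(1) _ that(4)])
    with that show ?thesis unfolding eventual_age_def by blast
  qed
  show "\<exists>K\<in>eventual_age G. verts H \<subseteq> verts K \<and> induced_subgraph K (verts H) = H \<and> has_RCIS K F"
    if "H \<in> eventual_age G" "F \<in> eventual_age G" for H F
    using eventual_age_joint_extension[OF G dec that] .
qed (rule exI, auto simp: eventual_age_def)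

definition graph_point :: "nat rgraph \<Rightarrow> graph_space" where
  "graph_point G = abs_graph_space (abs_graph_type G)"

lemma graph_point_surj: "\<exists>G. rooted_graph G \<and> connected_graph G \<and> graph_point G = x"
proof -
  obtain t where t: "x = abs_graph_space t" by (induct x rule: graph_space.abs_induct) blast
  obtain G where "same_type G G" "t = abs_graph_type G"
    by (induct t rule: graph_type.abs_induct) blast
  with t show ?thesis unfolding graph_point_def same_type_def by blast
qed

text \<open>The radius is at least \<open>1\<close>, so comparing the reciprocals amounts to comparing the radii; this turns
  all metric questions into questions about \<open>similar\<close>.\<close>

lemma dist_graph_point_le:
  assumes "rooted_graph G" "connected_graph G" "rooted_graph H" "connected_graph H" "0 < r"
  shows "dist (graph_point G) (graph_point H) \<le> 1 / real r \<longleftrightarrow> similar r G H"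
proof -
  have st: "same_type G G" "same_type H H" using assms by (auto simp: same_type_def rooted_iso_refl)
  let ?R = "similarity_radius G H"
  have R: "type_radius (abs_graph_type G) (abs_graph_type H) = ?R"
    using type_radius.abs_eq st by blast
  have "dist (graph_point G) (graph_point H) = (case ?R of enat r \<Rightarrow> 1 / real r | \<infinity> \<Rightarrow> 0)"
    unfolding graph_point_def dist_graph_space.abs_eq type_dist_def R ..
  moreover have "1 \<le> ?R" using type_radius_pos[of "abs_graph_type G" "abs_graph_type H"] R by simp
  moreover have "1 / real n \<le> 1 / real r \<longleftrightarrow> r \<le> n" if "1 \<le> n" for n
    using assms(5) that by (simp add: divide_simps)
  ultimately have "dist (graph_point G) (graph_point H) \<le> 1 / real r \<longleftrightarrow> enat r \<le> ?R"
    by (cases ?R) (auto simp: one_enat_def)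
  then show ?thesis using le_similarity_radius by simp
qed

text \<open>The signature \<open>\<sigma> x\<close> lists the small test graphs contained in \<open>x\<close>. It takes finitely many values,
  and points with equal signatures are closer than \<open>e\<close>, so one point for each value gives a net.\<close>

lemma totally_bounded_graph_space:
  assumes "e > 0"
  shows "\<exists>K. finite K \<and> (UNIV :: graph_space set) \<subseteq> (\<Union>x\<in>K. ball x e)"
proof -
  obtain r where r: "0 < r" "1 / real r < e"
    using assms by (metis nat_approx_posE zero_less_Suc)
  have "\<exists>G. \<forall>x. rooted_graph (G x) \<and> connected_graph (G x) \<and> graph_point (G x) = x"
    by (intro choice allI graph_point_surj)
  then obtain G
    where rep: "\<forall>x. rooted_graph (G x) \<and> connected_graph (G x) \<and> graph_point (G x) = x" ..
  then have G: "\<And>x. rooted_graph (G x)" "\<And>x. connected_graph (G x)" "\<And>x. graph_point (G x) = x"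
    by blast+
  define \<sigma> where "\<sigma> x = {F. rooted_graph F \<and> verts F \<subseteq> {..<r} \<and> has_RCIS (G x) F}" for x
  have "range \<sigma> \<subseteq> Pow {F. rooted_graph F \<and> verts F \<subseteq> {..<r}}" unfolding \<sigma>_def by blast
  then have fin: "finite (range \<sigma>)"
    by (rule finite_subset) (simp add: finite_rooted_graphs_on)
  have close: "dist x y < e" if "\<sigma> x = \<sigma> y" for x y
  proof -
    have "similar r (G x) (G y)"
      using that unfolding \<sigma>_def by (intro similar_by_initial_segment) blast
    then have "dist x y \<le> 1 / real r"
      using dist_graph_point_le[OF G(1,2) G(1,2) r(1), of x y] by (simp add: G(3))
    with r(2) show ?thesis by simp
  qed
  show ?thesis
  proof (intro exI conjI subsetI)
    show "finite (inv \<sigma> ` range \<sigma>)" using fin by blast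
    fix x
    have "\<sigma> (inv \<sigma> (\<sigma> x)) = \<sigma> x" by (rule f_inv_into_f) blast
    then show "x \<in> (\<Union>x\<in>inv \<sigma> ` range \<sigma>. ball x e)" using close by auto
  qed
qed

lemma complete_graph_space: "complete (UNIV :: graph_space set)"
proof (rule completeI)
  fix X :: "nat \<Rightarrow> graph_space" assume X: "Cauchy X"
  have "\<exists>G. \<forall>n. rooted_graph (G n) \<and> connected_graph (G n) \<and> graph_point (G n) = X n"
    by (intro choice allI graph_point_surj)
  then obtain G
    where rep: "\<forall>n. rooted_graph (G n) \<and> connected_graph (G n) \<and> graph_point (G n) = X n" ..
  then have G: "\<And>n. rooted_graph (G n)" "\<And>n. connected_graph (G n)" "\<And>n. graph_point (G n) = X n"
    by blast+
  have stab: "\<exists>N. \<forall>m\<ge>N. \<forall>n\<ge>N. similar r (G m) (G n)" if r: "0 < r" for r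
  proof -
    obtain N where "\<forall>m\<ge>N. \<forall>n\<ge>N. dist (X m) (X n) < 1 / real r"
      using metric_CauchyD[OF X, of "1 / real r"] r by auto
    then show ?thesis
      using dist_graph_point_le[OF G(1,2) G(1,2) r] unfolding G(3)[symmetric] by (meson less_imp_le)
  qed
  have dec: "(\<forall>\<^sub>F n in sequentially. has_RCIS (G n) F) \<or> (\<forall>\<^sub>F n in sequentially. \<not> has_RCIS (G n) F)"
    if F: "rooted_graph F" "finite (verts F)" for F :: "nat rgraph"
  proof -
    \<comment> \<open>The successor makes the radius visibly positive, as \<open>stab\<close> requires.\<close>
    obtain N where "\<forall>m\<ge>N. \<forall>n\<ge>N. similar (Suc (card (verts F))) (G m) (G n)"
      using stab by blast
    then have "\<forall>n\<ge>N. has_RCIS (G n) F \<longleftrightarrow> has_RCIS (G N) F"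
      using F unfolding similar_def by (meson le_SucI order_refl)
    then show ?thesis unfolding eventually_sequentially by blast
  qed
  have "\<exists>L :: nat rgraph. rooted_graph L \<and> connected_graph L \<and>
    (\<forall>F :: nat rgraph. rooted_graph F \<longrightarrow> finite (verts F) \<longrightarrow>
      (has_RCIS L F \<longleftrightarrow> (\<forall>\<^sub>F n in sequentially. has_RCIS (G n) F)))"
    using G(1) dec by (rule limit_graph_exists)
  then obtain L :: "nat rgraph" where L: "rooted_graph L" "connected_graph L"
    and age: "\<forall>F :: nat rgraph. rooted_graph F \<longrightarrow> finite (verts F) \<longrightarrow>
      (has_RCIS L F \<longleftrightarrow> (\<forall>\<^sub>F n in sequentially. has_RCIS (G n) F))"
    by (elim exE conjE)
  have "X \<longlonglongrightarrow> graph_point L"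
  proof (rule metric_LIMSEQ_I)
    fix e :: real assume "0 < e"
    then obtain r where r: "0 < r" "1 / real r < e" by (metis nat_approx_posE zero_less_Suc)
    obtain N where N: "\<And>m n. m \<ge> N \<Longrightarrow> n \<ge> N \<Longrightarrow> similar r (G m) (G n)"
      using stab[OF r(1)] by blast
    have "similar r (G n) L" if n: "n \<ge> N" for n
      unfolding similar_def
    proof (intro allI impI; elim conjE)
      fix F :: "nat rgraph" assume F: "rooted_graph F" "finite (verts F)" "card (verts F) \<le> r"
      have "\<forall>\<^sub>F m in sequentially. has_RCIS (G m) F \<longleftrightarrow> has_RCIS (G n) F"
        using N[OF _ n] F unfolding eventually_sequentially similar_def by blast
      then have "(\<forall>\<^sub>F m in sequentially. has_RCIS (G m) F) \<longleftrightarrow> (\<forall>\<^sub>F m in sequentially. has_RCIS (G n) F)"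
        by (rule eventually_subst)
      then show "has_RCIS (G n) F \<longleftrightarrow> has_RCIS L F" using age F by simp
    qed
    then have "\<forall>n\<ge>N. dist (X n) (graph_point L) < e"
      using dist_graph_point_le[OF G(1,2) L r(1)] r(2) unfolding G(3)[symmetric] by (meson le_less_trans)
    then show "\<exists>N. \<forall>n\<ge>N. dist (X n) (graph_point L) < e" by blast
  qed
  then show "\<exists>l\<in>UNIV. X \<longlonglongrightarrow> l" by blast
qed

theorem theorem5p4: "compact (UNIV :: graph_space set)"
  unfolding compact_eq_totally_bounded
  using complete_graph_space totally_bounded_graph_space by blast

end
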